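(* Let $d\ge 2$ be an integer, let $\mathcal{D}$ be a finite set of size $k\ge 2$, let $\epsilon\ge 0$, and let the users be partitioned into Phase I users and Phase II users. Then the Corr-RR mechanism satisfies $\epsilon$-LDP. That is: (i) for every Phase I user, the local randomized mechanism $\mathcal{M}_A:\mathcal{D}^d\to\mathcal{D}^d$ of Corr-RR satisfies $\epsilon$-LDP; and (ii) for every Phase II user, and every value of the published parameters $P=(p_{j\leftrightarrow s})_{j\ne s}$ with entries in $[0,1]$, the local randomized mechanism $\mathcal{M}_B=\mathcal{M}_{B,P}:\mathcal{D}^d\to\mathcal{D}^d$ of Corr-RR satisfies $\epsilon$-LDP.
   Context: **$\epsilon$-LDP (local differential privacy).** A randomized mechanism $\mathcal{M}:\mathcal{X}\to\mathcal{Y}$ satisfies $\epsilon$-LDP if for any two inputs $x,x'\in\mathcal{X}$ and any output $y\in\mathcal{Y}$, $\Pr[\mathcal{M}(x)=y]\le e^{\epsilon}\Pr[\mathcal{M}(x')=y]$. Here the input is a single user's whole record. **Generalized randomized response.** For $\eta\ge 0$, $\mathrm{GRR}(\cdot,\eta)$ is the randomized map $\mathcal{D}\to\mathcal{D}$ which, on input $v\in\mathcal{D}$, outputs $v$ with probability $\frac{e^{\eta}}{e^{\eta}+k-1}$ and outputs each $v'\in\mathcal{D}\setminus\{v\}$ with probability $\frac{1}{e^{\eta}+k-1}$. **Corr-RR (Correlated Randomized Response).** Each user $i$ holds a record $\mathbf{x}_i=(x_{i,1},\dots,x_{i,d})\in\mathcal{D}^d$ and sends a report $\mathbf{y}_i=(y_{i,1},\dots,y_{i,d})\in\mathcal{D}^d$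 produced with the user's own independent randomness. The users are split into two disjoint groups (fixed independently of the data). - Phase I user, mechanism $\mathcal{M}_A$: the coordinates are perturbed independently, $y_{i,j}=\mathrm{GRR}(x_{i,j},\epsilon/d)$ for $j=1,\dots,d$. - Between the phases, the server computes from the Phase I reports only (hence independently of the records of Phase II users) numbers $p_{j\leftrightarrow s}\in[0,1]$ for all ordered pairs $(j,s)$ with $j\neq s$, and publishes $P=(p_{j\leftrightarrow s})_{j\neq s}$. - Phase II user, mechanism $\mathcal{M}_{B,P}$: the user draws a pivot index $j$ uniformly at random from $\{1,\dots,d\}$, independently of the record, and sets $y_{i,j}=\mathrm{GRR}(x_{i,j},\epsilon)$. Then, independently for each $s\neq j$, given $y_{i,j}$, the user sets $y_{i,s}=y_{i,j}$ with probability $p_{j\leftrightarrow s}$, and otherwise draws $y_{i,s}$ uniformly from $\mathcal{D}\setminus\{y_{i,j}\}$. The report is $\mathbf{y}_i=(y_{i,1},\dots,y_{i,d})$ (the pivot index is not included). *)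

theory Defs
  imports "HOL-Probability.Probability"
begin

text \<open>A randomized mechanism from \<open>X\<close> to \<open>Y\<close> is a \<open>pmf\<close>-valued function; only its values on \<open>X\<close>
  matter, and there it has to produce outputs in \<open>Y\<close>.\<close>

definition randomized_mechanism :: "'x set \<Rightarrow> 'y set \<Rightarrow> ('x \<Rightarrow> 'y pmf) \<Rightarrow> bool" where
  "randomized_mechanism X Y M \<longleftrightarrow> (\<forall>x\<in>X. set_pmf (M x) \<subseteq> Y)"

definition satisfies_LDP :: "real \<Rightarrow> 'x set \<Rightarrow> 'y set \<Rightarrow> ('x \<Rightarrow> 'y pmf) \<Rightarrow> bool" where
  "satisfies_LDP \<epsilon> X Y M \<longleftrightarrow>
     randomized_mechanism X Y M \<and>
     (\<forall>x\<in>X. \<forall>x'\<in>X. \<forall>y\<in>Y. pmf (M x) y \<le> exp \<epsilon> * pmf (M x') y)"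

text \<open>Records and reports are the extensional functions on \<open>{1..d}\<close> with values in \<open>D\<close>. This is
  why \<open>undefined\<close> is the default value in the products \<open>Pi_pmf\<close> below.\<close>

abbreviation records :: "'a set \<Rightarrow> nat \<Rightarrow> (nat \<Rightarrow> 'a) set" where
  "records D d \<equiv> {1..d} \<rightarrow>\<^sub>E D"

text \<open>\<open>embed_pmf\<close> is meaningful only for nonnegative functions of total mass one; the lemma
  \<open>pmf_GRR\<close> below shows that this is the case for all inputs \<open>v \<in> D\<close>.\<close>

definition GRR :: "'a set \<Rightarrow> real \<Rightarrow> 'a \<Rightarrow> 'a pmf" where
  "GRR D \<eta> v = embed_pmf (\<lambda>w.
     if w = v then exp \<eta> / (exp \<eta> + real (card D) - 1)
     else if w \<in> D then 1 / (exp \<eta> + real (card D) - 1)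
     else 0)"

lemma pmf_GRR:
  assumes "finite D" and "v \<in> D"
  shows "pmf (GRR D \<eta> v) w =
     (if w = v then exp \<eta> / (exp \<eta> + real (card D) - 1)
      else if w \<in> D then 1 / (exp \<eta> + real (card D) - 1)
      else 0)"
proof -
  define c where "c = exp \<eta> + real (card D) - 1"
  define f where "f = (\<lambda>w. if w = v then exp \<eta> / c else if w \<in> D then 1 / c else 0)"
  have card: "card D \<ge> 1"
    using assms by (metis One_nat_def Suc_leI card_gt_0_iff empty_iff)
  then have c: "c > 0"
    using exp_gt_zero[of \<eta>] unfolding c_def by linarith
  have nonneg: "f w \<ge> 0" for w
    using c by (simp add: f_def)
  have "sum f D = f v + sum f (D - {v})"
    using assms by (simp add: sum.remove)
  also have "sum f (D - {v}) = (\<Sum>w\<in>D - {v}. 1 / c)"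
    by (intro sum.cong) (auto simp: f_def)
  also have "\<dots> = (real (card D) - 1) / c"
    using assms card by (simp add: of_nat_diff)
  also have "f v + (real (card D) - 1) / c = (exp \<eta> + (real (card D) - 1)) / c"
    by (simp add: f_def add_divide_distrib)
  also have "\<dots> = 1"
    using c by (simp add: c_def)
  finally have sum: "sum f D = 1" .
  have "(\<integral>\<^sup>+w. ennreal (f w) \<partial>count_space UNIV) = (\<Sum>w\<in>D. ennreal (f w))"
    using assms by (intro nn_integral_count_space') (auto simp: f_def)
  also have "\<dots> = 1"
    using sum nonneg by (simp add: sum_ennreal)
  finally have "pmf (embed_pmf f) w = f w"
    by (intro pmf_embed_pmf nonneg)
  then show ?thesis
    unfolding GRR_def f_def c_def .
qed

definition corr_rr_phase_I :: "'a set \<Rightarrow> nat \<Rightarrow> real \<Rightarrow> (nat \<Rightarrow> 'a) \<Rightarrow> (nat \<Rightarrow> 'a) pmf" where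
  "corr_rr_phase_I D d \<epsilon> x = Pi_pmf {1..d} undefined (\<lambda>j. GRR D (\<epsilon> / real d) (x j))"

definition copy_or_resample :: "'a set \<Rightarrow> real \<Rightarrow> 'a \<Rightarrow> 'a pmf" where
  "copy_or_resample D p y = do {
     copy \<leftarrow> bernoulli_pmf p;
     if copy then return_pmf y else pmf_of_set (D - {y})
   }"

text \<open>\<open>P j s\<close> is the published number for the ordered pair of pivot \<open>j\<close> and coordinate \<open>s\<close>; it
  need not be symmetric, and the diagonal is never used.\<close>

definition valid_params :: "nat \<Rightarrow> (nat \<Rightarrow> nat \<Rightarrow> real) \<Rightarrow> bool" where
  "valid_params d P \<longleftrightarrow> (\<forall>j\<in>{1..d}. \<forall>s\<in>{1..d}. j \<noteq> s \<longrightarrow> P j s \<in> {0..1})"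

definition corr_rr_phase_II ::
    "'a set \<Rightarrow> nat \<Rightarrow> real \<Rightarrow> (nat \<Rightarrow> nat \<Rightarrow> real) \<Rightarrow> (nat \<Rightarrow> 'a) \<Rightarrow> (nat \<Rightarrow> 'a) pmf" where
  "corr_rr_phase_II D d \<epsilon> P x = do {
     j \<leftarrow> pmf_of_set {1..d};
     y \<leftarrow> GRR D \<epsilon> (x j);
     Pi_pmf {1..d} undefined
       (\<lambda>s. if s = j then return_pmf y else copy_or_resample D (P j s) y)
   }"

text \<open>The local mechanism that user \<open>i\<close> runs, where \<open>U\<^sub>I\<close> is the set of Phase I users and all
  remaining users are Phase II users. Phase I users act before \<open>P\<close> is published and ignore it.\<close>

definition corr_rr_local ::
    "'u set \<Rightarrow> 'a set \<Rightarrow> nat \<Rightarrow> real \<Rightarrow> (nat \<Rightarrow> nat \<Rightarrow> real) \<Rightarrow> 'u \<Rightarrow> (nat \<Rightarrow> 'a) \<Rightarrow> (nat \<Rightarrow> 'a) pmf" where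
  "corr_rr_local U\<^sub>I D d \<epsilon> P i =
     (if i \<in> U\<^sub>I then corr_rr_phase_I D d \<epsilon> else corr_rr_phase_II D d \<epsilon> P)"

end

theory Submission
  imports Defs
begin

text \<open>In phase I the coordinates are independent, so the likelihood ratio is at most
  \<open>exp (\<epsilon> / d) ^ d = exp \<epsilon>\<close>. In phase II, conditionally on the pivot \<open>j\<close>, which does not depend on
  the record, the report is a post-processing of \<open>GRR D \<epsilon> (x j)\<close>; the ratio bound \<open>exp \<epsilon>\<close> survives
  post-processing and averaging over \<open>j\<close>.\<close>

text \<open>Post-processing: the mass at \<open>y\<close> averages the common kernel
  \<open>f\<close> with the weights of \<open>p\<close>, so a pointwise bound on the weights carries
  over. Computing in \<open>ennreal\<close> avoids integrability side conditions.\<close>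

lemma pmf_bind_le_mult_left:
  assumes "\<And>x. pmf p x \<le> c * pmf q x" and "c \<ge> 0"
  shows "pmf (bind_pmf p f) y \<le> c * pmf (bind_pmf q f) y"
proof -
  have "ennreal (pmf (bind_pmf p f) y) =
      (\<integral>\<^sup>+x. ennreal (pmf p x) * ennreal (pmf (f x) y) \<partial>count_space UNIV)"
    by (simp add: ennreal_pmf_bind nn_integral_measure_pmf)
  also have "\<dots> \<le> (\<integral>\<^sup>+x. ennreal c * (ennreal (pmf q x) * ennreal (pmf (f x) y)) \<partial>count_space UNIV)"
    using assms
    by (intro nn_integral_mono)
      (simp add: ennreal_mult[symmetric] ennreal_leI mult.assoc[symmetric] mult_right_mono)
  also have "\<dots> = ennreal (c * pmf (bind_pmf q f) y)"
    using \<open>c \<ge> 0\<close>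
    by (simp add: ennreal_mult nn_integral_cmult ennreal_pmf_bind nn_integral_measure_pmf)
  finally show ?thesis
    using \<open>c \<ge> 0\<close> by simp
qed

text \<open>Mixing: a randomness source shared by both inputs preserves a bound that holds for each
  of its outcomes. Restricting to the support matters later, where only pivots in
  \<open>{1..d}\<close> select coordinates known to lie in \<open>D\<close>.\<close>

lemma pmf_bind_le_mult_right:
  assumes "\<And>x. x \<in> set_pmf p \<Longrightarrow> pmf (f x) y \<le> c * pmf (g x) y" and "c \<ge> 0"
  shows "pmf (bind_pmf p f) y \<le> c * pmf (bind_pmf p g) y"
proof -
  have "ennreal (pmf (bind_pmf p f) y) = (\<integral>\<^sup>+x. ennreal (pmf (f x) y) \<partial>measure_pmf p)"
    by (simp add: ennreal_pmf_bind)
  also have "\<dots> \<le> (\<integral>\<^sup>+x. ennreal c * ennreal (pmf (g x) y) \<partial>measure_pmf p)"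
    using assms
    by (intro nn_integral_mono_AE) (simp add: AE_measure_pmf_iff ennreal_mult[symmetric] ennreal_leI)
  also have "\<dots> = ennreal (c * pmf (bind_pmf p g) y)"
    using \<open>c \<ge> 0\<close> by (simp add: ennreal_mult nn_integral_cmult ennreal_pmf_bind)
  finally show ?thesis
    using \<open>c \<ge> 0\<close> by simp
qed

lemma set_pmf_Pi_pmf_subset_PiE:
  assumes "finite A" and "\<And>i. i \<in> A \<Longrightarrow> set_pmf (p i) \<subseteq> B i"
  shows "set_pmf (Pi_pmf A undefined p) \<subseteq> Pi\<^sub>E A B"
  using assms by (fastforce simp: set_Pi_pmf PiE_dflt_def PiE_iff extensional_def)

lemma set_pmf_GRR_subset:
  assumes "finite D" and "v \<in> D"
  shows "set_pmf (GRR D \<eta> v) \<subseteq> D"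
  using assms by (auto simp: set_pmf_iff pmf_GRR split: if_splits)

lemma pmf_GRR_le:
  assumes "finite D" and "v \<in> D" and "v' \<in> D" and "\<eta> \<ge> 0"
  shows "pmf (GRR D \<eta> v) w \<le> exp \<eta> * pmf (GRR D \<eta> v') w"
proof -
  have "card D \<ge> 1"
    using assms by (metis One_nat_def Suc_leI card_gt_0_iff empty_iff)
  then have c: "exp \<eta> + real (card D) - 1 > 0"
    using exp_gt_zero[of \<eta>] by linarith
  \<comment> \<open>For \<open>w\<close> in \<open>D\<close> the two masses have ratio 1,
    \<open>exp \<eta>\<close> or \<open>exp (-\<eta>)\<close>. The first case needs this fact; the
    last, where \<open>w = v'\<close> differs from \<open>v\<close>, needs
    \<open>1 \<le> exp \<eta> * exp \<eta>\<close>.\<close>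
  have "1 \<le> exp \<eta>"
    using \<open>\<eta> \<ge> 0\<close> by simp
  moreover from this have "1 \<le> exp \<eta> * exp \<eta>"
    using mult_mono[of 1 "exp \<eta>" 1 "exp \<eta>"] by simp
  ultimately show ?thesis
    using assms c by (auto simp: pmf_GRR divide_right_mono)
qed

lemma corr_rr_phase_I_LDP:
  assumes "finite D" and "d \<ge> 1" and "\<epsilon> \<ge> 0"
  shows "satisfies_LDP \<epsilon> (records D d) (records D d) (corr_rr_phase_I D d \<epsilon>)"
  unfolding satisfies_LDP_def randomized_mechanism_def
proof (intro conjI ballI)
  fix x assume "x \<in> records D d"
  then show "set_pmf (corr_rr_phase_I D d \<epsilon> x) \<subseteq> records D d"
    unfolding corr_rr_phase_I_def
    using assms by (intro set_pmf_Pi_pmf_subset_PiE set_pmf_GRR_subset) auto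
next
  fix x x' y
  assume x: "x \<in> records D d" "x' \<in> records D d" and y: "y \<in> records D d"
  let ?p = "\<lambda>x j. pmf (GRR D (\<epsilon> / d) (x j)) (y j)"
  have "(\<Prod>j\<in>{1..d}. ?p x j) \<le> (\<Prod>j\<in>{1..d}. exp (\<epsilon> / d) * ?p x' j)"
    using x assms by (intro prod_mono conjI pmf_nonneg pmf_GRR_le) auto
  also have "\<dots> = exp (\<epsilon> / d) ^ d * (\<Prod>j\<in>{1..d}. ?p x' j)"
    by (simp add: prod.distrib)
  also have "exp (\<epsilon> / d) ^ d = exp \<epsilon>"
    using \<open>d \<ge> 1\<close> by (simp flip: exp_of_nat_mult)
  \<comment> \<open>\<open>pmf_Pi\<close> gives the product only for outcomes equal to the default
    outside the index set; extensionality of \<open>y\<close> supplies this.\<close>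
  finally show "pmf (corr_rr_phase_I D d \<epsilon> x) y \<le> exp \<epsilon> * pmf (corr_rr_phase_I D d \<epsilon> x') y"
    using PiE_arb[OF y] by (simp add: corr_rr_phase_I_def pmf_Pi)
qed

lemma set_pmf_copy_or_resample_subset:
  assumes "finite D" and "card D \<ge> 2" and "y \<in> D"
  shows "set_pmf (copy_or_resample D p y) \<subseteq> D"
proof -
  \<comment> \<open>The resampling set is nonempty because \<open>D\<close> has at least two
    elements; otherwise \<open>pmf_of_set\<close> would be unspecified.\<close>
  have "card (D - {y}) \<noteq> 0"
    using assms by simp
  then have "set_pmf (pmf_of_set (D - {y})) = D - {y}"
    using \<open>finite D\<close> by (intro set_pmf_of_set) auto
  then have "set_pmf (if copy then return_pmf y else pmf_of_set (D - {y})) \<subseteq> D" for copy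
    using \<open>y \<in> D\<close> by simp
  then show ?thesis
    unfolding copy_or_resample_def set_bind_pmf by blast
qed

lemma corr_rr_phase_II_LDP:
  assumes "finite D" and "card D \<ge> 2" and "d \<ge> 1" and "\<epsilon> \<ge> 0"
  shows "satisfies_LDP \<epsilon> (records D d) (records D d) (corr_rr_phase_II D d \<epsilon> P)"
  unfolding satisfies_LDP_def randomized_mechanism_def
proof (intro conjI ballI)
  let ?K = "\<lambda>j y. Pi_pmf {1..d} undefined
    (\<lambda>s. if s = j then return_pmf y else copy_or_resample D (P j s) y)"
  have pivots: "set_pmf (pmf_of_set {1..d}) = {1..d}"
    using \<open>d \<ge> 1\<close> by (intro set_pmf_of_set) auto
  {
    fix x assume x: "x \<in> records D d"
    have "set_pmf (?K j y) \<subseteq> records D d" if "y \<in> D" for j y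
      using that assms set_pmf_copy_or_resample_subset[of D y]
      by (intro set_pmf_Pi_pmf_subset_PiE) auto
    moreover have "set_pmf (GRR D \<epsilon> (x j)) \<subseteq> D" if "j \<in> {1..d}" for j
      using that x assms by (intro set_pmf_GRR_subset) auto
    ultimately show "set_pmf (corr_rr_phase_II D d \<epsilon> P x) \<subseteq> records D d"
      unfolding corr_rr_phase_II_def set_bind_pmf pivots by blast
  next
    fix x x' y
    assume "x \<in> records D d" "x' \<in> records D d"
    then show "pmf (corr_rr_phase_II D d \<epsilon> P x) y \<le> exp \<epsilon> * pmf (corr_rr_phase_II D d \<epsilon> P x') y"
      unfolding corr_rr_phase_II_def using assms
      \<comment> \<open>The pivot draw is common to both records, so the mixing bound applies first.
        For a fixed pivot \<open>j\<close>, the records enter only through \<open>x j\<close> and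
        \<open>x' j\<close>, and the remaining kernel is shared, so post-processing reduces the
        claim to \<open>GRR\<close>.\<close>
      by (intro pmf_bind_le_mult_right pmf_bind_le_mult_left pmf_GRR_le)
        (auto simp: pivots)
  }
qed

theorem theorem6:
  fixes D :: "'a set" and d k :: nat and \<epsilon> :: real and U U\<^sub>I U\<^sub>I\<^sub>I :: "'u set"
  assumes "d \<ge> 2"
    and "finite D" and "card D = k" and "k \<ge> 2"
    and "\<epsilon> \<ge> 0"
    and "U = U\<^sub>I \<union> U\<^sub>I\<^sub>I" and "U\<^sub>I \<inter> U\<^sub>I\<^sub>I = {}"
  shows "(\<forall>i\<in>U\<^sub>I. \<forall>P. satisfies_LDP \<epsilon> (records D d) (records D d) (corr_rr_local U\<^sub>I D d \<epsilon> P i)) \<and>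
    (\<forall>i\<in>U\<^sub>I\<^sub>I. \<forall>P. valid_params d P \<longrightarrow>
       satisfies_LDP \<epsilon> (records D d) (records D d) (corr_rr_local U\<^sub>I D d \<epsilon> P i))"
  \<comment> \<open>Disjointness of the groups sends every user in \<open>U\<^sub>I\<^sub>I\<close>
    to the else branch of \<open>corr_rr_local\<close>.\<close>
  using assms corr_rr_phase_I_LDP[of D d \<epsilon>] corr_rr_phase_II_LDP[of D d \<epsilon>]
  by (auto simp: corr_rr_local_def)

end
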